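(* Let $n \in \mathbb{N}$ be an odd perfect square. Then there is no solution $\mathbf{u} = (u_1,u_2,u_3) \in \mathbb{N}^3$ to $$\frac{4}{n} = \frac{1}{u_1} + \frac{1}{u_2} + \frac{1}{u_3}$$ satisfying either (1) $n \mid u_1$ and $\gcd(n, u_2u_3) = 1$; or (2) $\gcd(n,u_1) = 1$, $n \mid u_2$ and $n \mid u_3$.
   Context: $\mathbb{N}$ denotes the positive integers. *)

theory Defs
  imports
    "HOL-Computational_Algebra.Nth_Powers"
    "HOL-Number_Theory.Number_Theory"
begin

end

theory Submission
  imports Defs
begin

text \<open>
  Both cases are instances of \<open>k\<^sup>2 x (y + z) = y z (4 x - l\<^sup>2)\<close> with \<open>k, l\<close> odd,
  \<open>k\<close> coprime to \<open>y z\<close> and \<open>l\<close> coprime to \<open>x\<close>: one of \<open>k\<^sup>2, l\<^sup>2\<close> is \<open>n\<close> and the other is \<open>1\<close>.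
  Divisibility arguments parametrise the solutions as \<open>x = a b d\<close>, \<open>y = a c d\<close>, \<open>z = b c d\<close> with
  \<open>k\<^sup>2 e + l\<^sup>2 = 4 a b d\<close> and \<open>a + b = c e\<close>. Then \<open>-4 a\<^sup>2 d \<equiv> l\<^sup>2\<close> modulo \<open>e\<close>, so the
  Jacobi symbol of \<open>-d\<close> over \<open>e\<close> is \<open>1\<close>. On the other hand \<open>e \<equiv> 3\<close> modulo \<open>4\<close>, and reciprocity applied to
  \<open>k\<^sup>2 e \<equiv> -l\<^sup>2\<close> modulo \<open>4 d\<close> shows that the Jacobi symbol of \<open>d\<close> over \<open>e\<close> is \<open>1\<close>, a contradiction.
\<close>

section \<open>The Jacobi symbol\<close>

definition Jacobi :: "int \<Rightarrow> nat \<Rightarrow> int" where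
  "Jacobi a m = (\<Prod>p\<in>#prime_factorization m. Legendre a (int p))"

lemma Jacobi_1 [simp]: "Jacobi a (Suc 0) = 1"
  by (simp add: Jacobi_def)

lemma Jacobi_prime: "prime p \<Longrightarrow> Jacobi a p = Legendre a (int p)"
  by (simp add: Jacobi_def prime_factorization_prime)

lemma Jacobi_mult_right: "m > 0 \<Longrightarrow> m' > 0 \<Longrightarrow> Jacobi a (m * m') = Jacobi a m * Jacobi a m'"
  by (simp add: Jacobi_def prime_factorization_mult)

text \<open>Reduces a claim about Jacobi symbols over odd moduli to Legendre symbols, one prime
  factor at a time.\<close>

lemma odd_prime_induct [consumes 1, case_names 1 mult]:
  fixes m :: nat
  assumes "odd m" "P 1"
    and "\<And>p m. prime p \<Longrightarrow> odd p \<Longrightarrow> odd m \<Longrightarrow> P m \<Longrightarrow> P (p * m)"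
  shows "P m"
  using assms(1)
proof (induction m rule: prime_divisors_induct)
  case (unit m)
  then show ?case using assms(2) by simp
next
  case (factor p m)
  then show ?case using assms(3)[of p m] by simp
qed simp

lemma Legendre_cong: "[a = b] (mod p) \<Longrightarrow> Legendre a p = Legendre b p"
proof -
  assume c: "[a = b] (mod p)"
  have "[a = 0] (mod p) \<longleftrightarrow> [b = 0] (mod p)" "QuadRes p a \<longleftrightarrow> QuadRes p b"
    using c cong_trans cong_sym unfolding QuadRes_def by blast+
  then show ?thesis by (simp add: Legendre_def)
qed

lemma Legendre_values: "Legendre a p \<in> {-1, 0, 1}"
  by (simp add: Legendre_def)

text \<open>Two elements of {-1, 0, 1} differ by at most 2, while an odd \<open>p > 1\<close> is at
  least 3. This turns the congruences of Euler's criterion into equalities.\<close>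

lemma eq_if_cong_small:
  fixes x y :: int and p :: nat
  assumes "odd p" "p > 1" "[x = y] (mod int p)" "x \<in> {-1, 0, 1}" "y \<in> {-1, 0, 1}"
  shows "x = y"
proof (rule ccontr)
  assume "x \<noteq> y"
  have "int p dvd x - y" using assms(3) by (simp add: cong_iff_dvd_diff)
  then have "int p dvd \<bar>x - y\<bar>" by simp
  then have "int p \<le> \<bar>x - y\<bar>" using \<open>x \<noteq> y\<close> by (intro zdvd_imp_le) auto
  moreover have "p \<ge> 3" using assms(1,2) by (cases "p = 2") auto
  ultimately show False using assms(4,5) by auto
qed

lemma odd_prime_gt_2: "prime p \<Longrightarrow> odd p \<Longrightarrow> p > (2::nat)"
  using prime_ge_2_nat[of p] by (cases "p = 2") auto

lemma Legendre_mult: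
  assumes "prime p" "odd p"
  shows "Legendre (a * b) (int p) = Legendre a (int p) * Legendre b (int p)"
proof (rule eq_if_cong_small)
  have p: "p > 2" using assms by (rule odd_prime_gt_2)
  show "[Legendre (a * b) (int p) = Legendre a (int p) * Legendre b (int p)] (mod int p)"
    using euler_criterion[OF assms(1) p, of "a * b"]
      cong_mult[OF euler_criterion[OF assms(1) p, of a] euler_criterion[OF assms(1) p, of b]]
    by (simp add: power_mult_distrib) (meson cong_sym cong_trans)
  show "Legendre a (int p) * Legendre b (int p) \<in> {-1, 0, 1}"
    using Legendre_values[of a p] Legendre_values[of b p] by auto
qed (use assms odd_prime_gt_2[OF assms] Legendre_values in auto)

lemma Jacobi_mult_left: "odd m \<Longrightarrow> Jacobi (a * b) m = Jacobi a m * Jacobi b m"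
  by (induction m rule: odd_prime_induct)
    (simp_all add: Jacobi_mult_right Jacobi_prime prime_gt_0_nat odd_pos Legendre_mult)

lemma Jacobi_cong:
  assumes "odd m" "[a = b] (mod int m)"
  shows "Jacobi a m = Jacobi b m"
  using assms
proof (induction m rule: odd_prime_induct)
  case (mult p m)
  have "[a = b] (mod int p)" "[a = b] (mod int m)"
    using mult.prems by (auto intro: cong_dvd_modulus)
  then show ?case using mult
    by (simp add: Jacobi_mult_right Jacobi_prime prime_gt_0_nat odd_pos Legendre_cong[of a b])
qed simp

lemma Jacobi_nonzero:
  assumes "odd m" "coprime a (int m)"
  shows "Jacobi a m \<noteq> 0"
  using assms
proof (induction m rule: odd_prime_induct)
  case (mult p m)
  have "\<not> int p dvd a"
    using mult.prems mult.hyps by (metis coprime_common_divisor dvd_triv_left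
      not_prime_unit of_nat_mult prime_nat_int_transfer)
  then have "Legendre a (int p) \<noteq> 0" by (simp add: Legendre_def cong_0_iff)
  then show ?case using mult
    by (simp add: Jacobi_mult_right Jacobi_prime prime_gt_0_nat odd_pos)
qed simp

text \<open>As 1 * 1 = 1, the value is idempotent, and it is nonzero.\<close>

lemma Jacobi_one: "odd m \<Longrightarrow> Jacobi 1 m = 1"
  using Jacobi_mult_left[of m 1 1] Jacobi_nonzero[of m 1] by simp

section \<open>Residues modulo 4 and 8, and the symbol of -1\<close>

lemma mult_mod_eq_nat: "(a * b) mod c = (a mod c) * (b mod c) mod (c::nat)"
  by (simp add: mod_mult_eq)

lemma odd_mod_4: "odd m \<Longrightarrow> m mod 4 = 1 \<or> m mod 4 = (3::nat)"
  by presburger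

lemma odd_mod_8: "odd m \<Longrightarrow> m mod 8 = 1 \<or> m mod 8 = 3 \<or> m mod 8 = 5 \<or> m mod 8 = (7::nat)"
  by presburger

lemma neg_one_power_half:
  assumes "odd m"
  shows "(-1::int) ^ ((m - 1) div 2) = (if m mod 4 = 1 then 1 else -1)"
proof -
  have "even ((m - 1) div 2) \<longleftrightarrow> m mod 4 = 1" using assms by presburger
  then show ?thesis by simp
qed

lemma Legendre_minus_one:
  assumes "prime p" "odd p"
  shows "Legendre (-1) (int p) = (if p mod 4 = 1 then 1 else -1)"
proof (rule eq_if_cong_small)
  show "[Legendre (-1) (int p) = (if p mod 4 = 1 then 1 else -1)] (mod int p)"
    using euler_criterion[OF assms(1) odd_prime_gt_2[OF assms], of "-1"]
    unfolding neg_one_power_half[OF assms(2)] .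
qed (use assms odd_prime_gt_2[OF assms] Legendre_values in auto)

lemma Jacobi_minus_one: "odd m \<Longrightarrow> Jacobi (-1) m = (if m mod 4 = 1 then 1 else -1)"
proof (induction m rule: odd_prime_induct)
  case (mult p m)
  then show ?case
    using odd_mod_4[of p] odd_mod_4[of m]
    by (auto simp: Jacobi_mult_right Jacobi_prime prime_gt_0_nat odd_pos Legendre_minus_one
        mult_mod_eq_nat[of p m 4])
qed simp

text \<open>For odd arguments this is (-1)^((m-1)/2 * (p-1)/2), put in terms of residues so that
  case splits modulo 4 evaluate it.\<close>

definition reciprocity_sign :: "nat \<Rightarrow> nat \<Rightarrow> int" where
  "reciprocity_sign m p = (if m mod 4 = 3 \<and> p mod 4 = 3 then -1 else 1)"

lemma Legendre_reciprocity:
  assumes "prime p" "odd p" "prime q" "odd q"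
  shows "Legendre q p = Legendre p q * reciprocity_sign q p"
proof (cases "p = q")
  case True
  then show ?thesis by (simp add: Legendre_def cong_0_iff)
next
  case False
  have "Legendre p q * Legendre q p = (-1) ^ ((p - 1) div 2 * ((q - 1) div 2))"
    using Quadratic_Reciprocity assms False odd_prime_gt_2 by blast
  also have "\<dots> = reciprocity_sign q p"
    unfolding power_mult neg_one_power_half[OF assms(2)]
    using odd_mod_4[OF assms(2)] odd_mod_4[OF assms(4)] neg_one_power_half[OF assms(4)]
    by (auto simp: reciprocity_sign_def)
  finally have "Legendre p q * Legendre q p = reciprocity_sign q p" .
  \<comment> \<open>The product of the two symbols is 1 or -1, so both are nonzero and each is its
    own inverse.\<close>
  then show ?thesis
    using Legendre_values[of p q] Legendre_values[of q p]
    by (auto simp: reciprocity_sign_def split: if_splits)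
qed

text \<open>With the prime \<open>p\<close> fixed, both symbols and the sign are multiplicative in
  \<open>m\<close>, so the prime case suffices.\<close>

lemma Jacobi_reciprocity:
  assumes "odd m" "prime p" "odd p"
  shows "Legendre m p = Jacobi p m * reciprocity_sign m p"
  using assms(1)
proof (induction m rule: odd_prime_induct)
  case 1
  then show ?case
    using Jacobi_one[of p] assms by (simp add: Jacobi_prime reciprocity_sign_def)
next
  case (mult q m)
  have "reciprocity_sign (q * m) p = reciprocity_sign q p * reciprocity_sign m p"
    using odd_mod_4[OF mult.hyps(2)] odd_mod_4[OF mult.hyps(3)]
    by (auto simp: reciprocity_sign_def mult_mod_eq_nat[of q m 4])
  then show ?case
    using mult assms
    by (simp add: Legendre_mult Legendre_reciprocity[of p q] Jacobi_mult_right Jacobi_prime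
        prime_gt_0_nat odd_pos)
qed

text \<open>
  Since \<open>-2 \<equiv> p - 2\<close> modulo \<open>p\<close> and one of \<open>p\<close>, \<open>p - 2\<close> is \<open>1\<close> modulo \<open>4\<close>, reciprocity reduces
  the symbol of \<open>-2\<close> over a prime \<open>p\<close> to that of \<open>2\<close> over the smaller number \<open>p - 2\<close>.
\<close>
lemma Jacobi_two:
  "odd m \<Longrightarrow> Jacobi 2 m = (if m mod 8 = 1 \<or> m mod 8 = 7 then 1 else -1)"
proof (induction m rule: less_induct)
  case (less m)
  consider "m = 1" | "prime m" | p k where "prime p" "m = p * k" "k > 1"
  proof (cases "m = 1 \<or> prime m")
    case False
    then obtain p where "prime p" "p dvd m" using prime_factor_nat by blast
    then obtain k where k: "m = p * k" by blast
    have "k \<noteq> 0" "k \<noteq> 1" using k False less.prems \<open>prime p\<close> by (auto intro: Nat.gr0I)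
    then have "k > 1" by simp
    then show ?thesis using that(3) \<open>prime p\<close> k by blast
  qed (use that in blast)
  then show ?case
  proof cases
    case 1
    then show ?thesis by simp
  next
    case 2
    have m: "m > 2" using 2 less.prems by (rule odd_prime_gt_2)
    have odd: "odd (m - 2)" using m less.prems by simp
    have m_mod: "m mod 8 = ((m - 2) mod 8 + 2) mod 8" "m mod 4 = ((m - 2) mod 4 + 2) mod 4"
      using m by (simp_all only: mod_add_left_eq le_add_diff_inverse2 less_imp_le)
    have "Jacobi 2 m = Legendre (-1 * -2) (int m)" by (simp add: Jacobi_prime 2)
    also have "\<dots> = (if m mod 4 = 1 then 1 else -1) * Legendre (-2) (int m)"
      by (simp only: Legendre_mult[OF 2 less.prems] Legendre_minus_one[OF 2 less.prems])
    also have "Legendre (-2) (int m) = Legendre (int (m - 2)) (int m)"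
      using m by (intro Legendre_cong) (simp add: cong_iff_dvd_diff)
    also have "\<dots> = Jacobi (int m) (m - 2) * reciprocity_sign (m - 2) m"
      by (rule Jacobi_reciprocity[OF odd 2 less.prems])
    also have "reciprocity_sign (m - 2) m = 1"
    proof -
      show ?thesis unfolding reciprocity_sign_def m_mod(2) by simp
    qed
    also have "Jacobi (int m) (m - 2) = Jacobi 2 (m - 2)"
      using m by (intro Jacobi_cong[OF odd]) (simp add: cong_iff_dvd_diff)
    also have "\<dots> = (if (m - 2) mod 8 = 1 \<or> (m - 2) mod 8 = 7 then 1 else -1)"
      using m odd by (intro less.IH) auto
    finally have eq: "Jacobi 2 m = (if m mod 4 = 1 then 1 else -1) *
      ((if (m - 2) mod 8 = 1 \<or> (m - 2) mod 8 = 7 then 1 else -1) * 1)" .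
    have m_mod_4: "m mod 4 = (m mod 8) mod 4" by (simp add: mod_mod_cancel)
    show ?thesis
      unfolding eq m_mod_4 unfolding m_mod(1) using odd_mod_8[OF odd] by auto
  next
    case (3 p k)
    have "p > 1" using 3(1) by (rule prime_gt_1_nat)
    have odds: "odd p" "odd k" using less.prems 3 by auto
    have "p < m" "k < m" using \<open>p > 1\<close> 3 by auto
    then have "Jacobi 2 p = (if p mod 8 = 1 \<or> p mod 8 = 7 then 1 else -1)"
      "Jacobi 2 k = (if k mod 8 = 1 \<or> k mod 8 = 7 then 1 else -1)"
      using less.IH odds by auto
    \<comment> \<open>The residues 1 and 7 form a subgroup of index 2 in the odd residues modulo 8,
      so the claimed value is multiplicative.\<close>
    then show ?thesis
      using odd_mod_8[OF odds(1)] odd_mod_8[OF odds(2)] \<open>p > 1\<close> 3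
      by (auto simp: Jacobi_mult_right mult_mod_eq_nat[of p k 8])
  qed
qed

lemma odd_square_mod_8: "odd l \<Longrightarrow> l\<^sup>2 mod 8 = (1::nat)"
  using odd_mod_8[of l] by (auto simp: power2_eq_square mult_mod_eq_nat[of l l 8])

text \<open>Prime factors \<open>q\<close> of \<open>d\<close> are split off one by one, each having
  symbol 1 over \<open>m\<close>. For odd \<open>q\<close>, \<open>m\<close> is minus a square
  modulo \<open>q\<close>, so its symbol over \<open>q\<close> is that of -1; as \<open>m\<close> is
  3 modulo 4, the reciprocity sign is the same and cancels it. For \<open>q = 2\<close>,
  \<open>m\<close> is 7 modulo 8.\<close>

lemma Jacobi_eq_one_if_dvd_add_square:
  fixes d l m :: nat
  assumes "d > 0" "odd l" "coprime d l" "4 * d dvd m + l\<^sup>2"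
  shows "Jacobi (int d) m = 1"
  using assms(1,3,4)
proof (induction d rule: prime_divisors_induct)
  case (unit d)
  have "odd m"
    using unit assms(2) by (metis dvd_mult_left even_add even_power dvd_trans
      dvd_def mult_2 numeral_Bit0)
  then show ?case using unit by (simp add: Jacobi_one)
next
  case (factor q d)
  have l8: "l\<^sup>2 mod 8 = 1" using assms(2) by (rule odd_square_mod_8)
  have "4 dvd m + l\<^sup>2" using factor.prems(3) dvd_mult_left by blast
  then have m4: "m mod 4 = 3" using l8 by presburger
  then have oddm: "odd m" by presburger
  have dvd: "4 * d dvd m + l\<^sup>2"
    using factor.prems(3) by (metis dvd_mult_left mult.assoc mult.commute)
  have IH: "Jacobi (int d) m = 1"
    using factor.prems dvd by (intro factor.IH) auto
  have "Jacobi (int q) m = 1"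
  proof (cases "q = 2")
    case True
    then have "8 dvd m + l\<^sup>2"
      using factor.prems(3) dvd_mult_left[of 8 d "m + l\<^sup>2"] by (simp add: mult.assoc)
    then have "m mod 8 = 7" using l8 by presburger
    then show ?thesis using Jacobi_two[OF oddm] True by simp
  next
    case False
    then have oddq: "odd q" using factor.hyps by (metis primes_dvd_imp_eq two_is_prime_nat)
    have "q dvd m + l\<^sup>2" using factor.prems(3) by (meson dvd_mult_left dvd_mult_right)
    then have "int q dvd int (m + l\<^sup>2)" by (simp only: of_nat_dvd_iff)
    then have "[int m = -1 * (int l * int l)] (mod int q)"
      by (simp add: cong_iff_dvd_diff power2_eq_square)
    then have "Legendre m q = Legendre (-1 * (int l * int l)) q" by (rule Legendre_cong)
    also have "\<dots> = (if q mod 4 = 1 then 1 else -1) * (Legendre l q * Legendre l q)"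
      by (simp only: Legendre_mult[OF factor.hyps oddq] Legendre_minus_one[OF factor.hyps oddq])
    also have "Legendre l q * Legendre l q = 1"
    proof -
      have "\<not> q dvd l" using factor.prems(2) factor.hyps
        by (metis coprime_absorb_left coprime_mult_left_iff not_prime_unit)
      then show ?thesis
        using Legendre_values[of l q] by (auto simp: Legendre_def cong_0_iff)
    qed
    finally have "(if q mod 4 = 1 then 1 else -1) = Jacobi (int q) m * reciprocity_sign m q"
      using Jacobi_reciprocity[OF oddm factor.hyps oddq] by simp
    then show ?thesis
      using odd_mod_4[OF oddq] m4 by (auto simp: reciprocity_sign_def split: if_splits)
  qed
  then show ?case using IH oddm by (simp add: Jacobi_mult_left)
qed simp

section \<open>The equation\<close>

lemma no_solution_parametrised:
  fixes a b c d e k l :: nat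
  assumes "odd k" "odd l" "coprime l (a * b * d)" "d > 0" "k\<^sup>2 * e + l\<^sup>2 = 4 * (a * b * d)" "a + b = c * e"
  shows False
proof -
  have sq: "k\<^sup>2 mod 8 = 1" "l\<^sup>2 mod 8 = 1" using odd_square_mod_8 assms(1,2) by blast+
  have "(k\<^sup>2 * e + l\<^sup>2) mod 4 = (e + 1) mod 4"
  proof -
    have "k\<^sup>2 mod 4 = 1" "l\<^sup>2 mod 4 = 1" using sq by presburger+
    then have "[k\<^sup>2 * e + l\<^sup>2 = 1 * e + 1] (mod 4)"
      by (intro cong_add cong_mult) (auto simp: cong_def)
    then show ?thesis by (simp add: cong_def)
  qed
  then have e4: "e mod 4 = 3" unfolding assms(5) by presburger
  then have odde: "odd e" by presburger
  have "coprime d l" using assms(3) by (simp add: ac_simps)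
  \<comment> \<open>The square factor keeps the sum with \<open>l\<^sup>2\<close> divisible by
    \<open>4 * d\<close>; being a square, it does not affect the sign of the symbol.\<close>
  then have "Jacobi d (k\<^sup>2 * e) = 1"
    using assms by (intro Jacobi_eq_one_if_dvd_add_square[of d l]) auto
  then have "(Jacobi d k)\<^sup>2 * Jacobi d e = 1"
    using assms(1) odde by (simp add: Jacobi_mult_right power2_eq_square odd_pos)
  then have pos: "Jacobi d e > 0"
    by (metis zero_less_mult_iff zero_less_one not_less zero_le_power2)
  have "coprime l e"
  proof (rule coprimeI)
    fix r assume r: "r dvd l" "r dvd e"
    have "odd r" using r(1) assms(2) by (meson dvd_trans)
    have "r dvd 4 * (a * b * d)"
      unfolding assms(5)[symmetric] using r by (simp add: power2_eq_square)
    moreover have "coprime r 4"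
      using \<open>odd r\<close> coprime_mult_right_iff[of r 2 2] by simp
    ultimately have "r dvd a * b * d" by (simp add: coprime_dvd_mult_right_iff)
    then show "is_unit r" using r assms(3) coprime_common_divisor by blast
  qed
  then have nz: "Jacobi l e \<noteq> 0" using odde by (intro Jacobi_nonzero) auto
  \<comment> \<open>Modulo \<open>e\<close>, the two equations give l^2 = 4 a b d and b = -a, hence
    l^2 = -d (2 a)^2.\<close>
  have "int l * int l - -1 * int d * ((2 * int a) * (2 * int a)) =
    int (l\<^sup>2 + k\<^sup>2 * e) - int (4 * (a * b * d)) + 4 * int a * int d * int (a + b) - int e * (int k)\<^sup>2"
    by (simp add: algebra_simps power2_eq_square)
  also have "\<dots> = int e * (4 * int a * int d * int c - (int k)\<^sup>2)"
    using assms(5) unfolding assms(6) by (simp add: algebra_simps)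
  finally have "[int l * int l = -1 * int d * ((2 * int a) * (2 * int a))] (mod int e)"
    unfolding cong_iff_dvd_diff by simp
  then have "Jacobi (int l * int l) e = Jacobi (-1 * int d * ((2 * int a) * (2 * int a))) e"
    by (rule Jacobi_cong[OF odde])
  then have "(Jacobi l e)\<^sup>2 = - Jacobi d e * (Jacobi (2 * int a) e)\<^sup>2"
    unfolding Jacobi_mult_left[OF odde] Jacobi_minus_one[OF odde]
    using e4 by (simp add: power2_eq_square)
  \<comment> \<open>The left side is positive, while the right side is minus a product of
    nonnegative factors.\<close>
  moreover have "(Jacobi l e)\<^sup>2 > 0" using nz by simp
  ultimately show False using pos
    by (metis mult_minus_left neg_0_less_iff_less not_less mult_nonneg_nonneg less_imp_le zero_le_power2)
qed

lemma no_solution_square_coefficients: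
  fixes k l x y z :: nat
  assumes "x > 0" "y > 0" "odd k" "odd l" "coprime k (y * z)" "coprime l x"
    and eq: "k\<^sup>2 * x * (y + z) + l\<^sup>2 * y * z = 4 * x * y * z"
  shows False
proof -
  define g where "g = gcd y z"
  obtain a b where y: "y = g * a" and z: "z = g * b" and ab: "coprime a b"
    using gcd_coprime_exists[of y z] assms(2) unfolding g_def by (metis gcd_eq_0_iff mult.commute not_less0)
  have g: "g > 0" using assms(2) y by (cases g) auto
  have eq1: "k\<^sup>2 * x * (a + b) + l\<^sup>2 * g * a * b = 4 * x * g * a * b"
  proof -
    have "g * (k\<^sup>2 * x * (a + b) + l\<^sup>2 * g * a * b) = g * (4 * x * g * a * b)"
      using eq unfolding y z by (simp add: algebra_simps)
    then show ?thesis using g by simp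
  qed
  \<comment> \<open>All later factors arise like this: a number dividing two terms of the equation
    divides the third, coprimality moves it to a single factor, and the equation is then divided by
    it.\<close>
  have dvd: "a * b dvd k\<^sup>2 * x * (a + b)"
  proof -
    have "a * b dvd k\<^sup>2 * x * (a + b) + (l\<^sup>2 * g) * (a * b)"
      using eq1 by (metis dvd_triv_right mult.assoc)
    then show ?thesis by (meson dvd_add_left_iff dvd_triv_right)
  qed
  have "coprime (a * b) (a + b)"
  proof -
    have "coprime a (a + b)" "coprime b (a + b)" 
      using ab by (metis add.commute coprime_commute coprime_iff_gcd_eq_1 gcd_add2)+
    then show ?thesis by simp
  qed
  moreover have "coprime (a * b) (k\<^sup>2)"
    using assms(5) unfolding y z by (simp add: ac_simps)
  ultimately have "a * b dvd x"
    using dvd by (simp add: coprime_dvd_mult_left_iff coprime_dvd_mult_right_iff)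
  then obtain d where x: "x = a * b * d" by blast
  have pos: "a > 0" "b > 0" "d > 0" using assms(1) unfolding x by auto
  have eq2: "k\<^sup>2 * d * (a + b) + l\<^sup>2 * g = 4 * (a * b * d) * g"
  proof -
    have "(a * b) * (k\<^sup>2 * d * (a + b) + l\<^sup>2 * g) = (a * b) * (4 * (a * b * d) * g)"
      using eq1 unfolding x by (simp add: algebra_simps)
    then show ?thesis using pos by simp
  qed
  \<comment> \<open>Here \<open>d\<close> is coprime to \<open>l\<close> because it divides
    \<open>x\<close>.\<close>
  have "d dvd l\<^sup>2 * g"
  proof -
    have "d dvd d * (k\<^sup>2 * (a + b)) + l\<^sup>2 * g"
      using eq2 by (metis dvd_mult dvd_mult2 dvd_triv_right mult.assoc mult.commute)
    then show ?thesis by (meson dvd_add_right_iff dvd_triv_left)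
  qed
  moreover have "coprime d (l\<^sup>2)" using assms(6) unfolding x by (simp add: ac_simps)
  ultimately have "d dvd g" by (simp add: coprime_dvd_mult_right_iff)
  then obtain c where c: "g = c * d" by (metis dvd_def mult.commute)
  have eq3: "k\<^sup>2 * (a + b) + l\<^sup>2 * c = 4 * (a * b * d) * c"
  proof -
    have "d * (k\<^sup>2 * (a + b) + l\<^sup>2 * c) = d * (4 * (a * b * d) * c)"
      using eq2 unfolding c by (simp add: algebra_simps)
    then show ?thesis using pos by simp
  qed
  have cpos: "c > 0" using g c by auto
  \<comment> \<open>Here \<open>c\<close> is coprime to \<open>k\<close> because it divides
    \<open>y\<close>.\<close>
  have "c dvd k\<^sup>2 * (a + b)"
    using eq3 by (metis dvd_add_left_iff dvd_triv_right)
  moreover have "coprime c (k\<^sup>2)"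
    using assms(5) unfolding y z c by (simp add: ac_simps)
  ultimately have "c dvd a + b" by (simp add: coprime_dvd_mult_right_iff)
  then obtain e where e: "a + b = c * e" by blast
  have "c * (k\<^sup>2 * e + l\<^sup>2) = c * (4 * (a * b * d))"
    using eq3 unfolding e by (simp add: algebra_simps)
  then have "k\<^sup>2 * e + l\<^sup>2 = 4 * (a * b * d)" using cpos by simp
  then show False
    using no_solution_parametrised[of k l a b d e c] assms(3,4,6) pos e unfolding x by blast
qed

theorem corollary1p4:
  fixes n :: nat
  assumes "n > 0" and "odd n" and "is_square n"
  shows "\<not> (\<exists>u\<^sub>1 u\<^sub>2 u\<^sub>3 :: nat.
            u\<^sub>1 > 0 \<and> u\<^sub>2 > 0 \<and> u\<^sub>3 > 0 \<and>
            4 / rat_of_nat n = 1 / rat_of_nat u\<^sub>1 + 1 / rat_of_nat u\<^sub>2 + 1 / rat_of_nat u\<^sub>3 \<and>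
            ((n dvd u\<^sub>1 \<and> gcd n (u\<^sub>2 * u\<^sub>3) = 1) \<or>
             (gcd n u\<^sub>1 = 1 \<and> n dvd u\<^sub>2 \<and> n dvd u\<^sub>3)))"
proof clarify
  fix u v w :: nat
  assume pos: "u > 0" "v > 0" "w > 0"
    and eq: "4 / rat_of_nat n = 1 / rat_of_nat u + 1 / rat_of_nat v + 1 / rat_of_nat w"
    and cases: "(n dvd u \<and> gcd n (v * w) = 1) \<or> (gcd n u = 1 \<and> n dvd v \<and> n dvd w)"
  obtain k where k: "n = k\<^sup>2" using assms(3) by (auto elim: is_nth_powerE)
  have oddk: "odd k" using assms(2) k by simp
  have "rat_of_nat (4 * u * v * w) = rat_of_nat (n * (v * w + u * w + u * v))"
    using eq pos assms(1) by (simp add: field_simps)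
  then have nat_eq: "4 * u * v * w = n * (v * w + u * w + u * v)"
    unfolding of_nat_eq_iff .
  from cases show False
  proof (elim disjE conjE)
    assume "n dvd u" and gcd: "gcd n (v * w) = 1"
    then obtain x where x: "u = n * x" by blast
    \<comment> \<open>The square coefficients are \<open>n\<close> and 1, with \<open>x\<close> =
      u/n.\<close>
    have "n * (k\<^sup>2 * x * (v + w) + 1\<^sup>2 * v * w) = n * (4 * x * v * w)"
      using nat_eq unfolding x k by (simp add: algebra_simps)
    then have "k\<^sup>2 * x * (v + w) + 1\<^sup>2 * v * w = 4 * x * v * w" using assms(1) by simp
    moreover have "coprime k (v * w)" using gcd unfolding k coprime_iff_gcd_eq_1[symmetric] by simp
    ultimately show False
      using no_solution_square_coefficients[of x v k 1 w] pos x oddk by simp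
  next
    assume gcd: "gcd n u = 1" and "n dvd v" "n dvd w"
    then obtain y z where yz: "v = n * y" "w = n * z" by blast
    \<comment> \<open>The coefficients swap: 1 stands at \<open>u * (y + z)\<close> and
      \<open>n\<close> at \<open>y * z\<close>, so only coprimality of \<open>k\<close> and
      \<open>u\<close> remains to be checked.\<close>
    have "(n * n) * (1\<^sup>2 * u * (y + z) + k\<^sup>2 * y * z) = (n * n) * (4 * u * y * z)"
      using nat_eq unfolding yz k by (simp add: algebra_simps)
    then have "1\<^sup>2 * u * (y + z) + k\<^sup>2 * y * z = 4 * u * y * z" using assms(1) by simp
    moreover have "coprime k u" using gcd unfolding k coprime_iff_gcd_eq_1[symmetric] by simp
    ultimately show False
      using no_solution_square_coefficients[of u y 1 k z] pos yz oddk by simp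
  qed
qed

end
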